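(* For integers $r\ge 1$, $s\ge 2$ and each $m\in\{1,2,3\}$, $\chi_{la}(H_m(r,s))=3$.
   Context: For a graph $G=(V,E)$ with $|E|=m$ and no isolated vertices, a local antimagic labeling is a bijection $f:E\to\{1,\dots,m\}$ such that $f^+(u)\ne f^+(v)$ for every edge $uv$, where $f^+(x)=\sum f(e)$ over all edges $e$ incident to $x$. The local antimagic chromatic number $\chi_{la}(G)$ is the minimum, over all local antimagic labelings $f$ of $G$, of the number of distinct values taken by $f^+$ (also for disconnected graphs). Merging a set of vertices means identifying them into one vertex incident to all edges previously incident to any of them. Let $n=rs$. Take $n$ disjoint copies of $C_4(8,2)$ indexed $i=1,\dots,n$, the $i$-th copy having vertices $\{u_{i,t},v_{i,t}:1\le t\le 8\}$ and edges $u_{i,t}u_{i,t+1}$, $v_{i,t}v_{i,t+1}$ ($1\le t\le 8$, second index mod 8) and $u_{i,2j}v_{i,2j}$ ($1\le j\le 4$). For each $i$, define merged vertices as follows. In $H_1(n)$: $x_{i,1}=\{u_{i,1},u_{i,5}\}$, $x_{i,2}=\{u_{i,3},u_{i,7}\}$, $y_{i,1}=\{v_{i,1},v_{i,5}\}$, $y_{i,2}=\{v_{i,3},v_{i,7}\}$. In $H_2(n)$: $x_{i,1}=\{u_{i,1},v_{i,7}\}$, $x_{i,2}=\{u_{i,5},v_{i,3}\}$, $y_{i,1}=\{u_{i,3},v_{i,5}\}$, $y_{i,2}=\{u_{i,7},v_{i,1}\}$. In $H_3(n)$: $x_{i,1}=\{u_{i,1},v_{i,1}\}$, $x_{i,2}=\{u_{i,5},v_{i,5}\}$,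 $y_{i,1}=\{u_{i,3},v_{i,3}\}$, $y_{i,2}=\{u_{i,7},v_{i,7}\}$ (each listed pair is merged into the single named vertex). For $m=1,2,3$, $H_m(r,s)$ is obtained from $H_m(n)$ by merging, for each $b\in[1,r]$ and $j\in\{1,2\}$, the set $\{x_{(b-1)s+i,j}:1\le i\le s\}$ into one vertex and the set $\{y_{(b-1)s+i,j}:1\le i\le s\}$ into one vertex. *)

theory Defs
  imports Main
begin

text \<open>
  Edges are objects of their own, and \<open>ends G e\<close> is the set of endpoints of \<open>e\<close>.
  Hence merging vertices leaves the edge set untouched and only changes the incidences.
\<close>

record ('v, 'e) graph =
  verts :: "'v set"
  edges :: "'e set"
  ends :: "'e \<Rightarrow> 'v set"

definition induced_label :: "('v, 'e) graph \<Rightarrow> ('e \<Rightarrow> nat) \<Rightarrow> 'v \<Rightarrow> nat" where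
  "induced_label G f x = (\<Sum>e\<in>{e \<in> edges G. x \<in> ends G e}. f e)"

definition local_antimagic :: "('v, 'e) graph \<Rightarrow> ('e \<Rightarrow> nat) \<Rightarrow> bool" where
  "local_antimagic G f \<longleftrightarrow>
     bij_betw f (edges G) {1..card (edges G)} \<and>
     (\<forall>e\<in>edges G. \<forall>u v. ends G e = {u, v} \<longrightarrow> induced_label G f u \<noteq> induced_label G f v)"

text \<open>
  If \<open>G\<close> has no local antimagic labeling, the infimum below is the infimum of the empty set
  of natural numbers, which is \<open>0\<close>; a positive value is therefore an attained minimum.
\<close>

definition chi_la :: "('v, 'e) graph \<Rightarrow> nat" where
  "chi_la G = Inf {card (induced_label G f ` verts G) | f. local_antimagic G f}"

text \<open>
  \<open>merge P G\<close> merges every member of the family \<open>P\<close> of pairwise disjoint vertex sets into one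
  vertex. A vertex of the result is the set of the vertices of \<open>G\<close> identified in it: a member
  of \<open>P\<close>, or a singleton for a vertex not covered by \<open>P\<close>.
\<close>

definition merge_class :: "'v set set \<Rightarrow> 'v \<Rightarrow> 'v set" where
  "merge_class P v = insert v (\<Union>{A \<in> P. v \<in> A})"

definition merge :: "'v set set \<Rightarrow> ('v, 'e) graph \<Rightarrow> ('v set, 'e) graph" where
  "merge P G = \<lparr>verts = merge_class P ` verts G, edges = edges G,
                ends = (\<lambda>e. merge_class P ` ends G e)\<rparr>"

datatype vertex = U nat nat | V nat nat

text \<open>
  The graph of \<open>n\<close> disjoint copies of \<open>C\<^sub>4(8,2)\<close>; \<open>t mod 8 + 1\<close> is the successor of \<open>t\<close> in the
  cyclic order of \<open>1, \<dots>, 8\<close>. An edge is the set of its two endpoints here.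
\<close>

definition C482_copies :: "nat \<Rightarrow> (vertex, vertex set) graph" where
  "C482_copies n =
     \<lparr>verts = {U i t | i t. i \<in> {1..n} \<and> t \<in> {1..8}} \<union> {V i t | i t. i \<in> {1..n} \<and> t \<in> {1..8}},
      edges = {{U i t, U i (t mod 8 + 1)} | i t. i \<in> {1..n} \<and> t \<in> {1..8}}
            \<union> {{V i t, V i (t mod 8 + 1)} | i t. i \<in> {1..n} \<and> t \<in> {1..8}}
            \<union> {{U i (2 * j), V i (2 * j)} | i j. i \<in> {1..n} \<and> j \<in> {1..4}},
      ends = (\<lambda>e. e)\<rparr>"

text \<open>
  The pairs \<open>x\<^sub>i\<^sub>,\<^sub>j\<close> and \<open>y\<^sub>i\<^sub>,\<^sub>j\<close> of \<open>H\<^sub>m(n)\<close>, used only for \<open>m \<in> {1, 2, 3}\<close> and \<open>j \<in> {1, 2}\<close>.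
\<close>

definition xv :: "nat \<Rightarrow> nat \<Rightarrow> nat \<Rightarrow> vertex set" where
  "xv m i j =
     (if m = 1 then (if j = 1 then {U i 1, U i 5} else {U i 3, U i 7})
      else if m = 2 then (if j = 1 then {U i 1, V i 7} else {U i 5, V i 3})
      else (if j = 1 then {U i 1, V i 1} else {U i 5, V i 5}))"

definition yv :: "nat \<Rightarrow> nat \<Rightarrow> nat \<Rightarrow> vertex set" where
  "yv m i j =
     (if m = 1 then (if j = 1 then {V i 1, V i 5} else {V i 3, V i 7})
      else if m = 2 then (if j = 1 then {U i 3, V i 5} else {U i 7, V i 1})
      else (if j = 1 then {U i 3, V i 3} else {U i 7, V i 7}))"

text \<open>
  Every edge has an even-indexed endpoint, these are never merged, and no merged set contains two
  neighbours of the same even-indexed vertex; so neither loops nor parallel edges arise below.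
\<close>

definition H_copies :: "nat \<Rightarrow> nat \<Rightarrow> (vertex set, vertex set) graph" where
  "H_copies m n =
     merge ({xv m i j | i j. i \<in> {1..n} \<and> j \<in> {1, 2}} \<union> {yv m i j | i j. i \<in> {1..n} \<and> j \<in> {1, 2}})
       (C482_copies n)"

definition H :: "nat \<Rightarrow> nat \<Rightarrow> nat \<Rightarrow> (vertex set set, vertex set) graph" where
  "H m r s =
     merge ({{xv m ((b - 1) * s + i) j | i. i \<in> {1..s}} | b j. b \<in> {1..r} \<and> j \<in> {1, 2}}
          \<union> {{yv m ((b - 1) * s + i) j | i. i \<in> {1..s}} | b j. b \<in> {1..r} \<and> j \<in> {1, 2}})
       (H_copies m (r * s))"

end

theory Submission imports Defs begin

text \<open>
  Upper bound: the copies \<open>C\<^sub>4(8,2)\<close> carry a labeling, linear in the index of the copy, for which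
  every vertex of degree 2 has the sum \<open>20n + 1\<close> and the two ends of every spoke have the sums
  \<open>30n + 1\<close> and \<open>30n + 2\<close> in some order. Merging adds sums, so whichever vertices of degree 2 are
  paired, the merged vertices all get \<open>2s(20n + 1) > 30n + 2\<close>; one labeling serves \<open>m = 1, 2, 3\<close>.

  Lower bound: for \<open>m = 2, 3\<close> the graph contains a triangle. For \<open>m = 1\<close> a single block is bipartite
  with both sides of size \<open>4s + 2\<close>; two colours \<open>A\<close>, \<open>B\<close> would be constant on the sides, and since
  each side meets every edge exactly once, \<open>(4s + 2) A = (4s + 2) B\<close>.
\<close>

section \<open>Merging in an arbitrary graph\<close>

lemma merge_class_member:
  assumes "pairwise disjnt P" "A \<in> P" "v \<in> A"
  shows "merge_class P v = A"
proof -
  have "{B \<in> P. v \<in> B} = {A}"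
    using assms by (auto simp: pairwise_def disjnt_iff)
  then show ?thesis using assms(3) by (auto simp: merge_class_def)
qed

lemma merge_class_uncovered: "v \<notin> \<Union>P \<Longrightarrow> merge_class P v = {v}"
  by (auto simp: merge_class_def)

text \<open>Disjoint families make the classes a partition. Thus an edge meets a merged vertex
  exactly when one of its original ends lies in the class.\<close>

lemma merge_class_eq_iff:
  assumes "pairwise disjnt P"
  shows "merge_class P v = merge_class P w \<longleftrightarrow> w \<in> merge_class P v"
proof (cases "v \<in> \<Union>P")
  case True
  then obtain A where A: "A \<in> P" "v \<in> A" by blast
  then have "merge_class P v = A" by (rule merge_class_member[OF assms])
  then show ?thesis using merge_class_member[OF assms A(1)]
    by (metis insertI1 merge_class_def)
next
  case False
  then have v: "merge_class P v = {v}" by (rule merge_class_uncovered)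
  have "w \<in> merge_class P w" by (simp add: merge_class_def)
  then show ?thesis using v by auto
qed

text \<open>An uncovered vertex is alone in its class, and every class contains its own argument, so
  nothing else is identified with it. As every edge of the copies has an even end, which is never
  merged, this rules out loops in both merging steps.\<close>

lemma inj_on_merge_class_pair:
  assumes "a \<notin> \<Union>P"
  shows "inj_on (merge_class P) {a, b}"
proof -
  have "merge_class P a = {a}" using assms by (rule merge_class_uncovered)
  moreover have "b \<in> merge_class P b" by (simp add: merge_class_def)
  ultimately show ?thesis by (auto simp: inj_on_def)
qed

text \<open>Injectivity on the ends of every edge says that merging creates no loops.\<close>

lemma induced_label_merge:
  assumes P: "pairwise disjnt P" and fin: "finite (edges G)" "finite (merge_class P v)"
    and inj: "\<And>e. e \<in> edges G \<Longrightarrow> inj_on (merge_class P) (ends G e)"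
  shows "induced_label (merge P G) f (merge_class P v)
       = (\<Sum>w\<in>merge_class P v. induced_label G f w)"
proof -
  have "{e \<in> edges G. merge_class P v \<in> merge_class P ` ends G e}
      = (\<Union>w\<in>merge_class P v. {e \<in> edges G. w \<in> ends G e})"
    by (auto simp: image_iff merge_class_eq_iff[OF P])
  \<comment> \<open>An edge shared by two members of the class would become a loop. Without loops
    the stars are disjoint, and the sum over their union splits.\<close>
  moreover have "{e \<in> edges G. w \<in> ends G e} \<inter> {e \<in> edges G. w' \<in> ends G e} = {}"
    if "w \<in> merge_class P v" "w' \<in> merge_class P v" "w \<noteq> w'" for w w'
    using that inj by (auto simp: merge_class_eq_iff[OF P, symmetric] dest!: inj_onD)
  ultimately show ?thesis
    using fin by (simp add: induced_label_def merge_def sum.UNION_disjoint)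
qed

subsection \<open>Edges of the copies\<close>

text \<open>A single index below 20 runs through the \<open>U\<close>-cycle, then the
  \<open>V\<close>-cycle, then the spokes. A labeling can thus be given by a list of length 20, and
  vertex sums can be evaluated by simplification.\<close>

definition edge :: "nat \<Rightarrow> nat \<Rightarrow> vertex set" where
  "edge i k =
     (if k < 8 then {U i (k + 1), U i ((k + 1) mod 8 + 1)}
      else if k < 16 then {V i (k - 7), V i ((k - 7) mod 8 + 1)}
      else {U i (2 * (k - 15)), V i (2 * (k - 15))})"

fun copy :: "vertex \<Rightarrow> nat" where
  "copy (U i t) = i" | "copy (V i t) = i"

fun idx :: "vertex \<Rightarrow> nat" where
  "idx (U i t) = t" | "idx (V i t) = t"

lemma lessThan_20: "{..<20::nat} = {0,1,2,3,4,5,6,7,8,9,10,11,12,13,14,15,16,17,18,19}"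
  by (simp add: lessThan_nat_numeral) auto

lemma edges_C482: "edges (C482_copies n) = (\<lambda>(i, k). edge i k) ` ({1..n} \<times> {..<20})"
proof -
  have 1: "{{U i t, U i (t mod 8 + 1)} | i t. i \<in> {1..n} \<and> t \<in> {1..8}}
      = (\<lambda>(i, k). edge i k) ` ({1..n} \<times> {..<8})"
  proof -
    have "{U i t, U i (t mod 8 + 1)} \<in> (\<lambda>(i, k). edge i k) ` ({1..n} \<times> {..<8})"
      if "i \<in> {1..n}" "t \<in> {1..8}" for i t
      using that by (intro image_eqI[of _ _ "(i, t - 1)"]) (auto simp: edge_def)
    moreover have "edge i k \<in> {{U i t, U i (t mod 8 + 1)} | i t. i \<in> {1..n} \<and> t \<in> {1..8}}"
      if "i \<in> {1..n}" "k < 8" for i k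
      using that by (intro CollectI exI[of _ i] exI[of _ "k + 1"]) (auto simp: edge_def)
    ultimately show ?thesis by (intro equalityI subsetI; force)
  qed
  have 2: "{{V i t, V i (t mod 8 + 1)} | i t. i \<in> {1..n} \<and> t \<in> {1..8}}
      = (\<lambda>(i, k). edge i k) ` ({1..n} \<times> {8..<16})"
  proof -
    have "{V i t, V i (t mod 8 + 1)} \<in> (\<lambda>(i, k). edge i k) ` ({1..n} \<times> {8..<16})"
      if "i \<in> {1..n}" "t \<in> {1..8}" for i t
      using that by (intro image_eqI[of _ _ "(i, t + 7)"]) (auto simp: edge_def)
    moreover have "edge i k \<in> {{V i t, V i (t mod 8 + 1)} | i t. i \<in> {1..n} \<and> t \<in> {1..8}}"
      if "i \<in> {1..n}" "k \<in> {8..<16}" for i k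
      using that by (intro CollectI exI[of _ i] exI[of _ "k - 7"]) (auto simp: edge_def)
    ultimately show ?thesis by (intro equalityI subsetI; force)
  qed
  have 3: "{{U i (2 * j), V i (2 * j)} | i j. i \<in> {1..n} \<and> j \<in> {1..4}}
      = (\<lambda>(i, k). edge i k) ` ({1..n} \<times> {16..<20})"
  proof -
    have "{U i (2 * j), V i (2 * j)} \<in> (\<lambda>(i, k). edge i k) ` ({1..n} \<times> {16..<20})"
      if "i \<in> {1..n}" "j \<in> {1..4}" for i j
      using that by (intro image_eqI[of _ _ "(i, j + 15)"]) (auto simp: edge_def)
    moreover have "edge i k \<in> {{U i (2 * j), V i (2 * j)} | i j. i \<in> {1..n} \<and> j \<in> {1..4}}"
      if "i \<in> {1..n}" "k \<in> {16..<20}" for i k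
      using that by (intro CollectI exI[of _ i] exI[of _ "k - 15"]) (auto simp: edge_def)
    ultimately show ?thesis by (intro equalityI subsetI; force)
  qed
  have "{..<20::nat} = {..<8} \<union> {8..<16} \<union> {16..<20}" by auto
  then show ?thesis
    unfolding C482_copies_def graph.simps 1 2 3 by (simp add: Sigma_Un_distrib2 image_Un)
qed

lemma edge_simps:
  "edge i 0 = {U i 1, U i 2}" "edge i 1 = {U i 2, U i 3}"
  "edge i 2 = {U i 3, U i 4}" "edge i 3 = {U i 4, U i 5}"
  "edge i 4 = {U i 5, U i 6}" "edge i 5 = {U i 6, U i 7}"
  "edge i 6 = {U i 7, U i 8}" "edge i 7 = {U i 8, U i 1}"
  "edge i 8 = {V i 1, V i 2}" "edge i 9 = {V i 2, V i 3}"
  "edge i 10 = {V i 3, V i 4}" "edge i 11 = {V i 4, V i 5}"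
  "edge i 12 = {V i 5, V i 6}" "edge i 13 = {V i 6, V i 7}"
  "edge i 14 = {V i 7, V i 8}" "edge i 15 = {V i 8, V i 1}"
  "edge i 16 = {U i 2, V i 2}" "edge i 17 = {U i 4, V i 4}"
  "edge i 18 = {U i 6, V i 6}" "edge i 19 = {U i 8, V i 8}"
  by (simp_all add: edge_def flip: numeral_2_eq_2)

lemma mem_edge:
  "U i t \<in> edge i k \<longleftrightarrow> k < 8 \<and> (t = k + 1 \<or> t = (k + 1) mod 8 + 1) \<or> 16 \<le> k \<and> t = 2 * (k - 15)"
  "V i t \<in> edge i k \<longleftrightarrow> 8 \<le> k \<and> k < 16 \<and> (t = k - 7 \<or> t = (k - 7) mod 8 + 1)
     \<or> 16 \<le> k \<and> t = 2 * (k - 15)"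
  by (auto simp: edge_def)

lemma copy_edge: "v \<in> edge i k \<Longrightarrow> copy v = i"
  by (auto simp: edge_def split: if_splits)

lemma inj_on_edge: "inj_on (edge i) {..<20}"
proof (rule inj_onI)
  fix k k' assume *: "k \<in> {..<20}" "k' \<in> {..<20}" "edge i k = edge i k'"
  \<comment> \<open>Equal doubletons match directly or crosswise; a crosswise match would make
    \<open>a\<close> and \<open>b\<close> successors of each other, impossible in a cycle of length
    8.\<close>
  have cyc: "a = b" if "a = b \<or> a = b mod 8 + 1 \<and> a mod 8 + 1 = b" "a \<le> 8" "b \<le> 8" for a b :: nat
    using that by (cases "a = 7"; cases "a = 8"; cases "b = 7"; cases "b = 8") (auto simp: mod_less)
  consider "k < 8" | "8 \<le> k" "k < 16" | "16 \<le> k" by linarith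
  then show "k = k'"
  proof cases
    case 1
    then show ?thesis using * cyc[of "k + 1" "k' + 1"]
      by (auto simp: edge_def doubleton_eq_iff split: if_splits)
  next
    case 2
    then show ?thesis using * cyc[of "k - 7" "k' - 7"]
      by (auto simp: edge_def doubleton_eq_iff split: if_splits)
  next
    case 3
    then show ?thesis using *
      by (auto simp: edge_def doubleton_eq_iff split: if_splits)
  qed
qed

lemma inj_on_edges: "inj_on (\<lambda>(i, k). edge i k) ({1..n} \<times> {..<20})"
proof -
  have "i = i' \<and> k = k'" if *: "edge i k = edge i' k'" "k < 20" "k' < 20" for i k i' k'
  proof -
    have "edge i k \<noteq> {}" by (simp add: edge_def)
    then obtain v where v: "v \<in> edge i k" by blast
    then have "i = i'" using * copy_edge by metis
    then show ?thesis using * inj_on_edge[of i'] by (auto dest: inj_onD)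
  qed
  then show ?thesis by (auto simp: inj_on_def)
qed

text \<open>Indexing by \<open>k\<close> instead of summing over a set of edges lets
  \<open>lessThan_20\<close> and \<open>mem_edge\<close> compute the sums of all 16 kinds of
  vertices below.\<close>

lemma induced_label_C482:
  assumes "copy w = i" "i \<in> {1..n}"
  shows "induced_label (C482_copies n) f w = (\<Sum>k<20. if w \<in> edge i k then f (edge i k) else 0)"
proof -
  have ends: "ends (C482_copies n) = (\<lambda>e. e)" by (simp add: C482_copies_def)
  have "{e \<in> edges (C482_copies n). w \<in> e} = edge i ` {k \<in> {..<20}. w \<in> edge i k}"
    (is "?A = ?B")
  proof
    show "?A \<subseteq> ?B"
    proof
      fix e assume "e \<in> ?A"
      then obtain j k where e: "e = edge j k" "k < 20" "w \<in> edge j k" by (auto simp: edges_C482)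
      then have "j = i" using copy_edge assms(1) by blast
      then show "e \<in> ?B" using e by blast
    qed
    show "?B \<subseteq> ?A" using assms(2) by (force simp: edges_C482)
  qed
  moreover have "inj_on (edge i) {k \<in> {..<20}. w \<in> edge i k}"
    using inj_on_edge by (rule inj_on_subset) auto
  ultimately show ?thesis
    by (simp add: induced_label_def ends sum.reindex sum.inter_filter[symmetric])
qed

lemma induced_label_U:
  assumes "i \<in> {1..n}"
  shows "induced_label (C482_copies n) f (U i 1) = f (edge i 7) + f (edge i 0)"
    "induced_label (C482_copies n) f (U i 2) = f (edge i 0) + f (edge i 1) + f (edge i 16)"
    "induced_label (C482_copies n) f (U i 3) = f (edge i 1) + f (edge i 2)"
    "induced_label (C482_copies n) f (U i 4) = f (edge i 2) + f (edge i 3) + f (edge i 17)"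
    "induced_label (C482_copies n) f (U i 5) = f (edge i 3) + f (edge i 4)"
    "induced_label (C482_copies n) f (U i 6) = f (edge i 4) + f (edge i 5) + f (edge i 18)"
    "induced_label (C482_copies n) f (U i 7) = f (edge i 5) + f (edge i 6)"
    "induced_label (C482_copies n) f (U i 8) = f (edge i 6) + f (edge i 7) + f (edge i 19)"
  using assms by (simp_all add: induced_label_C482 lessThan_20 mem_edge)

lemma induced_label_V:
  assumes "i \<in> {1..n}"
  shows "induced_label (C482_copies n) f (V i 1) = f (edge i 15) + f (edge i 8)"
    "induced_label (C482_copies n) f (V i 2) = f (edge i 8) + f (edge i 9) + f (edge i 16)"
    "induced_label (C482_copies n) f (V i 3) = f (edge i 9) + f (edge i 10)"
    "induced_label (C482_copies n) f (V i 4) = f (edge i 10) + f (edge i 11) + f (edge i 17)"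
    "induced_label (C482_copies n) f (V i 5) = f (edge i 11) + f (edge i 12)"
    "induced_label (C482_copies n) f (V i 6) = f (edge i 12) + f (edge i 13) + f (edge i 18)"
    "induced_label (C482_copies n) f (V i 7) = f (edge i 13) + f (edge i 14)"
    "induced_label (C482_copies n) f (V i 8) = f (edge i 14) + f (edge i 15) + f (edge i 19)"
  using assms by (simp_all add: induced_label_C482 lessThan_20 mem_edge)

lemma atLeastAtMost_1_8: "t \<in> {1..8::nat} \<longleftrightarrow> t \<in> {1, 2, 3, 4, 5, 6, 7, 8}"
  by auto

subsection \<open>The two merging steps\<close>

text \<open>One index \<open>c\<close> for the four merged pairs of a copy allows the x- and
  y-vertices to be treated together in all later arguments.\<close>

definition slot :: "nat \<Rightarrow> nat \<Rightarrow> nat \<Rightarrow> vertex set" where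
  "slot m i c = (if c = 0 then xv m i 1 else if c = 1 then xv m i 2
                 else if c = 2 then yv m i 1 else yv m i 2)"

definition slots :: "nat \<Rightarrow> nat \<Rightarrow> vertex set set" where
  "slots m n = {slot m i c | i c. i \<in> {1..n} \<and> c < 4}"

definition block :: "nat \<Rightarrow> nat \<Rightarrow> nat \<Rightarrow> nat \<Rightarrow> vertex set set" where
  "block m s b c = (\<lambda>i. slot m ((b - 1) * s + i) c) ` {1..s}"

definition blocks :: "nat \<Rightarrow> nat \<Rightarrow> nat \<Rightarrow> vertex set set set" where
  "blocks m r s = {block m s b c | b c. b \<in> {1..r} \<and> c < 4}"

text \<open>The composite quotient map from the vertices of the copies to those of
  \<open>H m r s\<close>. Colours in the merged graph can thereby be discussed through vertices of
  the copies.\<close>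

definition proj :: "nat \<Rightarrow> nat \<Rightarrow> nat \<Rightarrow> vertex \<Rightarrow> vertex set set" where
  "proj m r s v = merge_class (blocks m r s) (merge_class (slots m (r * s)) v)"

lemma less_4_iff: "c < (4::nat) \<longleftrightarrow> c = 0 \<or> c = 1 \<or> c = 2 \<or> c = 3"
  by auto

lemma slot_simps:
  "slot m i 0 = xv m i 1" "slot m i 1 = xv m i 2" "slot m i 2 = yv m i 1" "slot m i 3 = yv m i 2"
  by (simp_all add: slot_def)

lemma H_copies_eq: "H_copies m n = merge (slots m n) (C482_copies n)"
proof -
  have x: "{xv m i j | i j. i \<in> {1..n} \<and> j \<in> {1, 2}}
      = {slot m i 0 | i. i \<in> {1..n}} \<union> {slot m i 1 | i. i \<in> {1..n}}"
    unfolding slot_simps by blast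
  have y: "{yv m i j | i j. i \<in> {1..n} \<and> j \<in> {1, 2}}
      = {slot m i 2 | i. i \<in> {1..n}} \<union> {slot m i 3 | i. i \<in> {1..n}}"
    unfolding slot_simps by blast
  have "slots m n = {slot m i 0 | i. i \<in> {1..n}} \<union> {slot m i 1 | i. i \<in> {1..n}}
      \<union> ({slot m i 2 | i. i \<in> {1..n}} \<union> {slot m i 3 | i. i \<in> {1..n}})"
    unfolding slots_def less_4_iff by blast
  then show ?thesis unfolding H_copies_def x y by simp
qed

lemma H_eq: "H m r s = merge (blocks m r s) (H_copies m (r * s))"
proof -
  have block: "block m s b c = {slot m ((b - 1) * s + i) c | i. i \<in> {1..s}}" for b c
    unfolding block_def by blast
  have x: "{{xv m ((b - 1) * s + i) j | i. i \<in> {1..s}} | b j. b \<in> {1..r} \<and> j \<in> {1, 2}}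
      = {block m s b 0 | b. b \<in> {1..r}} \<union> {block m s b 1 | b. b \<in> {1..r}}"
    unfolding block slot_simps by blast
  have y: "{{yv m ((b - 1) * s + i) j | i. i \<in> {1..s}} | b j. b \<in> {1..r} \<and> j \<in> {1, 2}}
      = {block m s b 2 | b. b \<in> {1..r}} \<union> {block m s b 3 | b. b \<in> {1..r}}"
    unfolding block slot_simps by blast
  have "blocks m r s = {block m s b 0 | b. b \<in> {1..r}} \<union> {block m s b 1 | b. b \<in> {1..r}}
      \<union> ({block m s b 2 | b. b \<in> {1..r}} \<union> {block m s b 3 | b. b \<in> {1..r}})"
    unfolding blocks_def less_4_iff by blast
  then show ?thesis unfolding H_def x y by simp
qed

lemma slot_copy_idx: "w \<in> slot m i c \<Longrightarrow> copy w = i \<and> odd (idx w)"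
  by (auto simp: slot_def xv_def yv_def split: if_splits)

lemma slot_inj:
  assumes "w \<in> slot m i c" "w \<in> slot m i' c'" "c < 4" "c' < 4"
  shows "i = i' \<and> c = c'"
proof -
  have "i = i'" using assms slot_copy_idx by blast
  then show ?thesis using assms
    unfolding less_4_iff by (auto simp: slot_def xv_def yv_def split: if_splits)
qed

lemma slot_nonempty: "slot m i c \<noteq> {}"
  by (auto simp: slot_def xv_def yv_def)

lemma finite_slot: "finite (slot m i c)"
  by (auto simp: slot_def xv_def yv_def)

lemma pairwise_slots: "pairwise disjnt (slots m n)"
  unfolding pairwise_def slots_def disjnt_iff using slot_inj by blast

text \<open>Division with remainder, the remainders being shifted to 1, ..., n. It serves both the
  numbering of copies within blocks and the offsets within the progressions of
  \<open>level\<close>.\<close>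

lemma mult_add_unique:
  fixes q q' n i i' :: nat
  assumes eq: "q * n + i = q' * n + i'" and i: "i \<in> {1..n}" "i' \<in> {1..n}"
  shows "q = q' \<and> i = i'"
proof -
  obtain j j' where j: "i = Suc j" "i' = Suc j'" "j < n" "j' < n"
    using i by (cases i; cases i') auto
  then have "q * n + j = q' * n + j'" using eq by simp
  moreover have "q = (q * n + j) div n" "q' = (q' * n + j') div n" using j by simp_all
  ultimately have "q = q'" by simp
  then show ?thesis using eq by simp
qed

lemma block_index_unique:
  fixes b b' s i i' :: nat
  assumes "(b - 1) * s + i = (b' - 1) * s + i'" "i \<in> {1..s}" "i' \<in> {1..s}" "1 \<le> b" "1 \<le> b'"
  shows "b = b' \<and> i = i'"
  using mult_add_unique[OF assms(1-3)] assms(4,5) by auto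

lemma pairwise_blocks: "pairwise disjnt (blocks m r s)"
proof -
  have "b = b' \<and> c = c'"
    if *: "A \<in> block m s b c" "A \<in> block m s b' c'" "c < 4" "c' < 4" "1 \<le> b" "1 \<le> b'" for A b b' c c'
  proof -
    obtain i where i: "i \<in> {1..s}" "A = slot m ((b - 1) * s + i) c"
      using *(1) unfolding block_def by blast
    obtain i' where i': "i' \<in> {1..s}" "A = slot m ((b' - 1) * s + i') c'"
      using *(2) unfolding block_def by blast
    obtain w where "w \<in> A" using i slot_nonempty by blast
    then have "(b - 1) * s + i = (b' - 1) * s + i' \<and> c = c'"
      using * i i' by (intro slot_inj) auto
    then show ?thesis using block_index_unique * i i' by blast
  qed
  then have "disjnt (block m s b c) (block m s b' c')"
    if "block m s b c \<noteq> block m s b' c'" "c < 4" "c' < 4" "1 \<le> b" "1 \<le> b'" for b b' c c'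
    using that unfolding disjnt_iff by blast
  then show ?thesis unfolding pairwise_def blocks_def atLeastAtMost_iff by blast
qed

lemma even_uncovered: "even (idx w) \<Longrightarrow> w \<notin> \<Union>(slots m n)"
  by (auto simp: slots_def dest: slot_copy_idx)

lemma singleton_uncovered: "even (idx w) \<Longrightarrow> {w} \<notin> \<Union>(blocks m r s)"
  using slot_copy_idx by (fastforce simp: blocks_def block_def)

text \<open>Merged pairs contain only odd indices, so an even vertex passes through both merging
  steps; each step adds one pair of braces.\<close>

lemma proj_even: "even (idx w) \<Longrightarrow> proj m r s w = {{w}}"
  using merge_class_uncovered[OF even_uncovered] merge_class_uncovered[OF singleton_uncovered]
  by (simp add: proj_def)

lemma block_index_range:
  fixes b r i s :: nat
  assumes "b \<in> {1..r}" "i \<in> {1..s}"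
  shows "(b - 1) * s + i \<in> {1..r * s}"
proof -
  have "(b - 1) * s + s = b * s" using assms by (cases b) auto
  moreover have "b * s \<le> r * s" using assms by simp
  moreover have "1 \<le> i" "i \<le> s" using assms by auto
  ultimately show ?thesis by (simp only: atLeastAtMost_iff) linarith
qed

lemma slot_in_slots: "i \<in> {1..n} \<Longrightarrow> c < 4 \<Longrightarrow> slot m i c \<in> slots m n"
  by (auto simp: slots_def)

lemma proj_slot:
  assumes "b \<in> {1..r}" "i \<in> {1..s}" "c < 4" "w \<in> slot m ((b - 1) * s + i) c"
  shows "proj m r s w = block m s b c"
proof -
  have "merge_class (slots m (r * s)) w = slot m ((b - 1) * s + i) c"
    using assms block_index_range by (intro merge_class_member[OF pairwise_slots] slot_in_slots) auto
  moreover have "slot m ((b - 1) * s + i) c \<in> block m s b c" "block m s b c \<in> blocks m r s"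
    using assms by (auto simp: block_def blocks_def)
  ultimately show ?thesis unfolding proj_def by (simp add: merge_class_member[OF pairwise_blocks])
qed

section \<open>Incidences and vertex sums of the merged graph\<close>

lemma edges_H: "edges (H m r s) = edges (C482_copies (r * s))"
  by (simp add: H_eq H_copies_eq merge_def)

lemma ends_H: "ends (H m r s) e = proj m r s ` e"
  by (simp add: H_eq H_copies_eq merge_def proj_def C482_copies_def image_image)

lemma verts_H: "verts (H m r s) = proj m r s ` verts (C482_copies (r * s))"
  by (simp add: H_eq H_copies_eq merge_def proj_def image_image)

lemma finite_edges_C482: "finite (edges (C482_copies n))"
  by (simp add: edges_C482)

lemma verts_C482: "verts (C482_copies n) = {w. copy w \<in> {1..n} \<and> idx w \<in> {1..8}}"
proof -
  have "w \<in> verts (C482_copies n) \<longleftrightarrow> copy w \<in> {1..n} \<and> idx w \<in> {1..8}" for w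
    by (cases w) (auto simp: C482_copies_def)
  then show ?thesis by auto
qed

lemma finite_verts_H: "finite (verts (H m r s))"
proof -
  have "verts (C482_copies (r * s))
      = case_prod U ` ({1..r * s} \<times> {1..8}) \<union> case_prod V ` ({1..r * s} \<times> {1..8})"
    by (auto simp: C482_copies_def)
  then show ?thesis by (simp add: verts_H)
qed

text \<open>Orients each edge with an even end first: cycle edges join opposite parities, spokes
  join two even vertices. The even end excludes loops, and the dichotomy for the other end is the
  case split in checking that the labeling is proper.\<close>

lemma edge_cases:
  assumes "e \<in> edges (C482_copies n)"
  obtains v w where "e = {v, w}" "even (idx v)"
    "odd (idx w) \<or> (\<exists>i j. j \<in> {1..4} \<and> v = U i (2 * j) \<and> w = V i (2 * j))"
proof -
  obtain i k where e: "e = edge i k" "k < 20" using assms by (auto simp: edges_C482)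
  \<comment> \<open>Reduction modulo the even number 8 keeps parity, so the cyclic successor flips
    it even at the wrap-around.\<close>
  have par: "even (a mod 8 + 1) \<longleftrightarrow> odd a" for a :: nat
    using dvd_mod_iff[of 2 8 a] by simp
  consider "k < 8" "odd k" | "k < 8" "even k" | "8 \<le> k" "k < 16" "odd k"
    | "8 \<le> k" "k < 16" "even k" | "16 \<le> k"
    by linarith
  then show ?thesis
  proof cases
    case 1
    have "e = {U i (k + 1), U i ((k + 1) mod 8 + 1)}" using 1 e by (simp add: edge_def)
    then show ?thesis by (rule that) (unfold idx.simps par, use 1 in simp_all)
  next
    case 2
    have "e = {U i ((k + 1) mod 8 + 1), U i (k + 1)}" using 2 e by (simp add: edge_def insert_commute)
    then show ?thesis by (rule that) (unfold idx.simps par, use 2 in simp_all)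
  next
    case 3
    have "e = {V i (k - 7), V i ((k - 7) mod 8 + 1)}" using 3 e by (simp add: edge_def)
    then show ?thesis by (rule that) (unfold idx.simps par, use 3 in simp_all)
  next
    case 4
    have "e = {V i ((k - 7) mod 8 + 1), V i (k - 7)}" using 4 e by (simp add: edge_def insert_commute)
    then show ?thesis by (rule that) (unfold idx.simps par, use 4 in simp_all)
  next
    case 5
    have "e = {U i (2 * (k - 15)), V i (2 * (k - 15))}" using 5 e by (simp add: edge_def)
    moreover have "k - 15 \<in> {1..4}" using 5 e by auto
    ultimately show ?thesis by (intro that) auto
  qed
qed

text \<open>Two applications of \<open>induced_label_merge\<close>, first to the blocks and then to
  the slots. For the inner one, each member of the outer class has to be a finite class of the first
  merging; the second assumption provides this.\<close>

lemma induced_label_H: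
  assumes "finite (proj m r s v)" "\<And>A. A \<in> proj m r s v \<Longrightarrow> \<exists>w. A = merge_class (slots m (r * s)) w \<and> finite A"
  shows "induced_label (H m r s) f (proj m r s v)
    = (\<Sum>A\<in>proj m r s v. \<Sum>w\<in>A. induced_label (C482_copies (r * s)) f w)"
proof -
  let ?n = "r * s"
  have "induced_label (H m r s) f (proj m r s v)
    = (\<Sum>A\<in>proj m r s v. induced_label (H_copies m ?n) f A)"
    unfolding H_eq proj_def
  proof (rule induced_label_merge[OF pairwise_blocks])
    show "finite (edges (H_copies m ?n))"
      by (simp add: H_copies_eq merge_def finite_edges_C482)
    show "finite (merge_class (blocks m r s) (merge_class (slots m (r * s)) v))"
      using assms(1) by (simp add: proj_def)
    fix e assume "e \<in> edges (H_copies m ?n)"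
    then have "e \<in> edges (C482_copies ?n)" by (simp add: H_copies_eq merge_def)
    then obtain v w where e: "e = {v, w}" "even (idx v)" by (rule edge_cases)
    have "merge_class (slots m ?n) v = {v}" "{v} \<notin> \<Union>(blocks m r s)"
      using merge_class_uncovered[OF even_uncovered] singleton_uncovered e(2) by blast+
    then have "ends (H_copies m ?n) e = {{v}, merge_class (slots m ?n) w}" "{v} \<notin> \<Union>(blocks m r s)"
      by (simp_all add: H_copies_eq merge_def C482_copies_def e(1) del: Union_iff)
    then show "inj_on (merge_class (blocks m r s)) (ends (H_copies m ?n) e)"
      by (metis inj_on_merge_class_pair)
  qed
  moreover have "induced_label (H_copies m ?n) f A = (\<Sum>w\<in>A. induced_label (C482_copies ?n) f w)"
    if A: "A \<in> proj m r s v" for A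
  proof -
    obtain w where w: "A = merge_class (slots m ?n) w" "finite A" using assms(2) A by blast
    show ?thesis
      unfolding w(1) H_copies_eq
    proof (rule induced_label_merge[OF pairwise_slots finite_edges_C482])
      show "finite (merge_class (slots m ?n) w)" using w by simp
      fix e assume "e \<in> edges (C482_copies ?n)"
      then obtain v w where e: "e = {v, w}" "even (idx v)" by (rule edge_cases)
      then have "ends (C482_copies ?n) e = {v, w}" by (simp add: C482_copies_def)
      then show "inj_on (merge_class (slots m ?n)) (ends (C482_copies ?n) e)"
        using inj_on_merge_class_pair[OF even_uncovered] e(2) by metis
    qed
  qed
  ultimately show ?thesis by simp
qed

lemma induced_label_H_even:
  assumes "even (idx w)"
  shows "induced_label (H m r s) f {{w}} = induced_label (C482_copies (r * s)) f w"
  using induced_label_H[of m r s w f] assms merge_class_uncovered[OF even_uncovered, of w m "r * s"]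
  by (auto simp: proj_even)

lemma induced_label_H_block:
  assumes b: "b \<in> {1..r}" and c: "c < 4" and s: "1 \<le> s"
  shows "induced_label (H m r s) f (block m s b c)
    = (\<Sum>i\<in>{1..s}. \<Sum>w\<in>slot m ((b - 1) * s + i) c. induced_label (C482_copies (r * s)) f w)"
proof -
  obtain w where w: "w \<in> slot m ((b - 1) * s + 1) c" using slot_nonempty by blast
  have p: "proj m r s w = block m s b c" using proj_slot[OF b _ c w] s by simp
  have "\<exists>w. A = merge_class (slots m (r * s)) w \<and> finite A" if "A \<in> block m s b c" for A
  proof -
    have "A \<in> (\<lambda>i. slot m ((b - 1) * s + i) c) ` {1..s}" using that by (simp add: block_def)
    then obtain i where i: "i \<in> {1..s}" "A = slot m ((b - 1) * s + i) c" by blast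
    obtain w where w: "w \<in> A" using i slot_nonempty by blast
    have "merge_class (slots m (r * s)) w = A"
      unfolding i(2) using i w c block_index_range[OF b i(1)]
      by (intro merge_class_member[OF pairwise_slots] slot_in_slots) auto
    moreover have "finite A" unfolding i(2) by (rule finite_slot)
    ultimately show ?thesis by (intro exI[of _ w]) simp
  qed
  then have "induced_label (H m r s) f (block m s b c)
    = (\<Sum>A\<in>block m s b c. \<Sum>w\<in>A. induced_label (C482_copies (r * s)) f w)"
    using induced_label_H[of m r s w f] unfolding p by (simp add: block_def)
  \<comment> \<open>Different copies contribute different slots, so the sum over the set
    \<open>block m s b c\<close> may be indexed by \<open>i\<close>.\<close>
  moreover have "inj_on (\<lambda>i. slot m ((b - 1) * s + i) c) {1..s}"
  proof (rule inj_onI)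
    fix i j assume "slot m ((b - 1) * s + i) c = slot m ((b - 1) * s + j) c"
    then show "i = j"
      using slot_inj[OF _ _ c c] slot_nonempty by (metis add_left_cancel all_not_in_conv)
  qed
  ultimately show ?thesis unfolding block_def by (simp add: sum.reindex)
qed

subsection \<open>A labeling with three colours\<close>

text \<open>
  The labels \<open>1, \<dots>, 20n\<close> are split into 20 progressions of length \<open>n\<close>: \<open>level n i b\<close> is the \<open>i\<close>-th term of
  progression \<open>b\<close>, of step 2 for the odd and even halves of the four middle intervals of length
  \<open>2n\<close>, of step 1 otherwise. A vertex of degree 3 meets one progression of step 2 and two of
  step 1 running the opposite way, so its sum does not depend on \<open>i\<close>. The permutation \<open>position\<close>,
  which makes the constants agree as well, was found by computer search.
\<close>

definition position :: "nat list" where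
  "position = [4,9,10,1,18,8,11,15,0,12,7,5,14,13,6,19,16,17,2,3]"

definition level :: "nat \<Rightarrow> nat \<Rightarrow> nat \<Rightarrow> nat" where
  "level n i b = (if b \<in> {6..<14} then 2 * n * (b div 2) + 2 * i - 1 + b mod 2 else n * b + i)"

text \<open>At a vertex of degree 2 one edge number is even and the other odd, so their progressions
  run in opposite directions. Their entries in \<open>position\<close> add up to 19, which pairs
  each label a with 20n + 1 - a.\<close>

definition lab :: "nat \<Rightarrow> nat \<Rightarrow> nat \<Rightarrow> nat" where
  "lab n i k = level n (if even k then i else n + 1 - i) (position ! k)"

section \<open>Bijectivity of the labeling\<close>

lemma level_high:
  assumes "i \<in> {1..n}" "b \<in> {14..<20}"
  shows "level n i b \<in> {14 * n<..20 * n}"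
proof -
  have "n * 14 \<le> n * b" "n * b \<le> n * 19" using assms by (intro mult_le_mono2; simp)+
  moreover have "level n i b = n * b + i" "1 \<le> i" "i \<le> n" using assms by (auto simp: level_def)
  ultimately show ?thesis by (simp only: greaterThanAtMost_iff) linarith
qed

text \<open>Isolates the truncated subtraction at the end: the label is 2q + p - 1 with a bit p, so
  its parity reveals \<open>b mod 2\<close> and the rest reveals \<open>b div 2\<close> and
  \<open>i\<close>.\<close>

lemma level_middle_eq:
  assumes "i \<in> {1..n}" "b \<in> {6..<14}"
  shows "level n i b = 2 * (n * (b div 2) + i) + b mod 2 - 1"
proof -
  have "1 \<le> i" using assms by simp
  then show ?thesis using assms(2) by (simp add: level_def algebra_simps)
qed

lemma level_middle:
  assumes "i \<in> {1..n}" "b \<in> {6..<14}"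
  shows "level n i b \<in> {6 * n<..14 * n}"
proof -
  have "b div 2 \<in> {3..6}" using assms by auto
  then have "n * 3 \<le> n * (b div 2)" "n * (b div 2) \<le> n * 6" by (intro mult_le_mono2; simp)+
  moreover have "b mod 2 \<le> 1" by simp
  moreover have "1 \<le> i" "i \<le> n" using assms by auto
  moreover have "6 * n < 2 * (q + i) + p - 1 \<and> 2 * (q + i) + p - 1 \<le> 14 * n"
    if "n * 3 \<le> q" "q \<le> n * 6" "p \<le> 1" "1 \<le> i" "i \<le> n" for p q :: nat
    using that by auto
  ultimately show ?thesis by (simp only: level_middle_eq[OF assms] greaterThanAtMost_iff)
qed

lemma level_low:
  assumes "i \<in> {1..n}" "b < 6"
  shows "level n i b \<in> {0<..6 * n}"
proof -
  have "n * b \<le> n * 5" using assms by (intro mult_le_mono2; simp)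
  moreover have "level n i b = n * b + i" "1 \<le> i" "i \<le> n" using assms by (auto simp: level_def)
  ultimately show ?thesis by (simp only: greaterThanAtMost_iff) linarith
qed

lemma level_range:
  assumes "i \<in> {1..n}" "b < 20"
  shows "level n i b \<in> {1..20 * n}"
proof -
  consider "b < 6" | "b \<in> {6..<14}" | "b \<in> {14..<20}" using assms(2) by fastforce
  then show ?thesis
    using level_low[OF assms(1)] level_middle[OF assms(1)] level_high[OF assms(1)]
    by cases fastforce+
qed

text \<open>The middle range 6n + 1, ..., 14n is filled by the progressions of step 2 only. Within
  it, parity and then division by n recover the indices; outside it, division by n alone
  does.\<close>

lemma level_inj:
  assumes eq: "level n i b = level n i' b'" and i: "i \<in> {1..n}" "i' \<in> {1..n}"
    and b: "b < 20" "b' < 20"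
  shows "i = i' \<and> b = b'"
proof -
  have less: "level n i b < level n i' b'"
    if "i \<in> {1..n}" "i' \<in> {1..n}" "b < 6 \<and> 6 \<le> b' \<or> b < 14 \<and> 14 \<le> b'" "b' < 20" for i i' b b'
  proof (cases "b' < 14")
    case True
    then have "level n i b \<in> {0<..6 * n}" "level n i' b' \<in> {6 * n<..14 * n}"
      using that by (auto intro!: level_low level_middle simp del: greaterThanAtMost_iff)
    then show ?thesis by simp
  next
    case False
    then have "14 * n < level n i' b'" using level_high[of i' n b'] that by simp
    moreover have "level n i b \<le> 14 * n"
      using level_low[of i n b] level_middle[of i n b] that False by (cases "b < 6") auto
    ultimately show ?thesis by simp
  qed
  \<comment> \<open>The low and the high progressions share one formula, so only the middle has to
    be told apart from the rest.\<close>
  have same: "b \<in> {6..<14} \<longleftrightarrow> b' \<in> {6..<14}"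
    using less[OF i, of b b'] less[OF i(2,1), of b' b] eq b by (simp, linarith)
  show ?thesis
  proof (cases "b \<in> {6..<14}")
    case True
    define q q' where "q = n * (b div 2) + i" and "q' = n * (b' div 2) + i'"
    have "1 \<le> q" "1 \<le> q'" using i by (simp_all add: q_def q'_def)
    moreover have "2 * q + b mod 2 - 1 = 2 * q' + b' mod 2 - 1"
      using eq True same i by (simp add: level_middle_eq q_def q'_def)
    moreover have "x = x' \<and> p = p'"
      if "2 * x + p - 1 = 2 * x' + p' - 1" "1 \<le> x" "1 \<le> x'" "p < 2" "p' < 2" for x x' p p' :: nat
      using that by arith
    moreover have "b mod 2 < 2" "b' mod 2 < 2" by simp_all
    ultimately have "q = q' \<and> b mod 2 = b' mod 2" by blast
    then have "b div 2 * n + i = b' div 2 * n + i'" and mod: "b mod 2 = b' mod 2"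
      by (simp_all add: q_def q'_def mult.commute)
    then have "b div 2 = b' div 2" "i = i'" using mult_add_unique i by blast+
    then show ?thesis using mod by (metis div_mult_mod_eq)
  next
    case False
    then show ?thesis
      using mult_add_unique[of b n i b' i'] eq same i unfolding level_def mult.commute[of n] by auto
  qed
qed

lemma position_less: "k < 20 \<Longrightarrow> position ! k < 20"
  and position_inj: "k < 20 \<Longrightarrow> k' < 20 \<Longrightarrow> position ! k = position ! k' \<Longrightarrow> k = k'"
proof -
  have "list_all (\<lambda>x. x < 20) position" "distinct position" "length position = 20"
    by (simp_all add: position_def)
  then show "k < 20 \<Longrightarrow> position ! k < 20"
    "k < 20 \<Longrightarrow> k' < 20 \<Longrightarrow> position ! k = position ! k' \<Longrightarrow> k = k'"
    by (simp_all add: list_all_length nth_eq_iff_index_eq)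
qed

lemma bij_lab: "bij_betw (\<lambda>(i, k). lab n i k) ({1..n} \<times> {..<20}) {1..20 * n}"
proof -
  have range: "lab n i k \<in> {1..20 * n}" if "i \<in> {1..n}" "k < 20" for i k
    unfolding lab_def using that position_less by (intro level_range) auto
  have "i = i' \<and> k = k'"
    if *: "lab n i k = lab n i' k'" "i \<in> {1..n}" "i' \<in> {1..n}" "k < 20" "k' < 20" for i i' k k'
  proof -
    let ?j = "if even k then i else n + 1 - i" and ?j' = "if even k' then i' else n + 1 - i'"
    have "?j = ?j' \<and> position ! k = position ! k'"
      using *(2,3) position_less[OF *(4)] position_less[OF *(5)]
      by (intro level_inj[OF *(1)[unfolded lab_def]]) auto
    then have j: "?j = ?j'" and k: "k = k'" using position_inj *(4,5) by blast+
    have "i = i'" using j *(2,3) unfolding k atLeastAtMost_iff by (cases "even k'"; simp; linarith)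
    then show ?thesis using k by blast
  qed
  then have inj: "inj_on (\<lambda>(i, k). lab n i k) ({1..n} \<times> {..<20})"
    unfolding inj_on_def Ball_def split_paired_All mem_Sigma_iff prod.case prod.inject lessThan_iff
    by blast
  \<comment> \<open>Surjectivity by counting: 20n distinct values inside an interval of 20n
    numbers.\<close>
  have "(\<lambda>(i, k). lab n i k) ` ({1..n} \<times> {..<20}) = {1..20 * n}"
  proof (rule card_subset_eq)
    show "(\<lambda>(i, k). lab n i k) ` ({1..n} \<times> {..<20}) \<subseteq> {1..20 * n}" using range by auto
    show "card ((\<lambda>(i, k). lab n i k) ` ({1..n} \<times> {..<20})) = card {1..20 * n}"
      unfolding card_image[OF inj] by simp
  qed simp
  then show ?thesis using inj by (simp add: bij_betw_def)
qed

lemma labeling_exists: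
  obtains f where "bij_betw f (edges (C482_copies n)) {1..card (edges (C482_copies n))}"
    "\<And>i k. i \<in> {1..n} \<Longrightarrow> k < 20 \<Longrightarrow> f (edge i k) = lab n i k"
proof -
  let ?I = "{1..n} \<times> {..<20::nat}"
  let ?e = "\<lambda>(i, k). edge i k" and ?g = "\<lambda>(i, k). lab n i k"
  have e: "bij_betw ?e ?I (edges (C482_copies n))"
    using inj_on_edges by (simp add: edges_C482 bij_betw_def)
  have "card (edges (C482_copies n)) = 20 * n"
    using bij_betw_same_card[OF e] by simp
  moreover have "bij_betw (?g \<circ> the_inv_into ?I ?e) (edges (C482_copies n)) {1..20 * n}"
    using bij_betw_the_inv_into[OF e] bij_lab by (rule bij_betw_trans)
  moreover have "(?g \<circ> the_inv_into ?I ?e) (edge i k) = lab n i k" if "i \<in> {1..n}" "k < 20" for i k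
    using the_inv_into_f_f[OF inj_on_edges, of "(i, k)" n] that by simp
  ultimately show ?thesis using that by metis
qed

text \<open>A check of the 16 vertices of a copy, in which \<open>i\<close> cancels. The exceptional
  set contains exactly one end of each of the four spokes, which makes the two ends of a spoke
  differ.\<close>

lemma weights:
  assumes f: "\<And>i k. i \<in> {1..n} \<Longrightarrow> k < 20 \<Longrightarrow> f (edge i k) = lab n i k"
    and w: "copy w \<in> {1..n}" "idx w \<in> {1..8}"
  shows "induced_label (C482_copies n) f w
    = (if odd (idx w) then 20 * n + 1
       else if w \<in> {U (copy w) 2, U (copy w) 8, V (copy w) 4, V (copy w) 6} then 30 * n + 2
       else 30 * n + 1)"
proof -
  define i where "i = copy w"
  have i: "i \<in> {1..n}" and i': "1 \<le> i" "i \<le> n" using w by (simp_all add: i_def)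
  note f = f[OF i]
  have "induced_label (C482_copies n) f (U i t)
      = (if odd t then 20 * n + 1 else if t \<in> {2, 8} then 30 * n + 2 else 30 * n + 1)"
    if "t \<in> {1, 2, 3, 4, 5, 6, 7, 8}" for t
    using that i'
    by (elim insertE emptyE; simp only: induced_label_U[OF i] f; simp add: f lab_def level_def position_def)
  moreover have "induced_label (C482_copies n) f (V i t)
      = (if odd t then 20 * n + 1 else if t \<in> {4, 6} then 30 * n + 2 else 30 * n + 1)"
    if "t \<in> {1, 2, 3, 4, 5, 6, 7, 8}" for t
    using that i'
    by (elim insertE emptyE; simp only: induced_label_V[OF i] f; simp add: f lab_def level_def position_def)
  ultimately show ?thesis
    using w(2) i_def unfolding atLeastAtMost_1_8 by (cases w) (auto split: if_splits)
qed

lemma slot_idx: "w \<in> slot m i c \<Longrightarrow> idx w \<in> {1..8}"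
  by (auto simp: slot_def xv_def yv_def split: if_splits)

lemma card_slot: "card (slot m i c) = 2"
  by (simp add: slot_def xv_def yv_def)

lemma odd_in_slot:
  assumes "idx w \<in> {1..8}" "odd (idx w)"
  obtains c where "c < 4" "w \<in> slot m (copy w) c"
proof -
  have "w \<in> slot m (copy w) 0 \<or> w \<in> slot m (copy w) 1 \<or> w \<in> slot m (copy w) 2 \<or> w \<in> slot m (copy w) 3"
    using assms unfolding atLeastAtMost_1_8 slot_simps
    by (cases w) (auto simp: xv_def yv_def)
  then show ?thesis using that less_4_iff by blast
qed

lemma block_index_exists:
  fixes i r s :: nat
  assumes "i \<in> {1..r * s}"
  obtains b j where "b \<in> {1..r}" "j \<in> {1..s}" "i = (b - 1) * s + j"
proof
  have s: "0 < s" using assms by (cases s) auto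
  have "i - 1 < r * s" using assms unfolding atLeastAtMost_iff by linarith
  then have "(i - 1) div s < r" using s by (simp add: div_less_iff_less_mult)
  then show "(i - 1) div s + 1 \<in> {1..r}" by simp
  show "(i - 1) mod s + 1 \<in> {1..s}" using s by (simp add: Suc_le_eq)
  show "i = ((i - 1) div s + 1 - 1) * s + ((i - 1) mod s + 1)" using assms by simp
qed

lemma proj_odd:
  assumes "w \<in> verts (C482_copies (r * s))" "odd (idx w)"
  obtains b c where "b \<in> {1..r}" "c < 4" "proj m r s w = block m s b c"
proof -
  have w: "copy w \<in> {1..r * s}" "idx w \<in> {1..8}" using assms(1) by (auto simp: verts_C482)
  obtain b j where b: "b \<in> {1..r}" "j \<in> {1..s}" "copy w = (b - 1) * s + j"
    using block_index_exists[OF w(1)] by blast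
  obtain c where c: "c < 4" "w \<in> slot m (copy w) c" using odd_in_slot[OF w(2) assms(2)] by blast
  then show ?thesis using that b proj_slot[of b r j s c w m] by metis
qed

section \<open>The upper bound\<close>

lemma chi_la_H_le:
  assumes "1 \<le> r" "2 \<le> s"
  shows "\<exists>f. local_antimagic (H m r s) f \<and> card (induced_label (H m r s) f ` verts (H m r s)) \<le> 3"
proof -
  let ?n = "r * s" and ?G = "H m r s"
  obtain f where bij: "bij_betw f (edges (C482_copies ?n)) {1..card (edges (C482_copies ?n))}"
    and f: "\<And>i k. i \<in> {1..?n} \<Longrightarrow> k < 20 \<Longrightarrow> f (edge i k) = lab ?n i k"
    by (rule labeling_exists) blast
  have odd_label: "induced_label ?G f (proj m r s w) = 2 * s * (20 * ?n + 1)"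
    if w: "w \<in> verts (C482_copies ?n)" "odd (idx w)" for w
  proof -
    obtain b c where b: "b \<in> {1..r}" "c < 4" "proj m r s w = block m s b c"
      using proj_odd[OF w] by blast
    have "induced_label (C482_copies ?n) f v = 20 * ?n + 1"
      if i: "i \<in> {1..s}" and v: "v \<in> slot m ((b - 1) * s + i) c" for i v
      using weights[OF f, of v] slot_idx[OF v] slot_copy_idx[OF v] block_index_range[OF b(1) i] by simp
    then have "induced_label ?G f (block m s b c) = (\<Sum>i\<in>{1..s}. \<Sum>v\<in>slot m ((b - 1) * s + i) c. 20 * ?n + 1)"
      using assms b by (simp add: induced_label_H_block)
    also have "\<dots> = 2 * s * (20 * ?n + 1)" by (simp add: card_slot)
    finally show ?thesis using b(3) by simp
  qed
  have even_label: "induced_label ?G f (proj m r s w)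
      = (if w \<in> {U (copy w) 2, U (copy w) 8, V (copy w) 4, V (copy w) 6} then 30 * ?n + 2 else 30 * ?n + 1)"
    if w: "w \<in> verts (C482_copies ?n)" "even (idx w)" for w
  proof -
    have "copy w \<in> {1..?n}" "idx w \<in> {1..8}" using w by (auto simp: verts_C482)
    then show ?thesis
      unfolding proj_even[OF w(2)] induced_label_H_even[OF w(2)]
      using weights[OF f, of w] w(2) by simp
  qed
  \<comment> \<open>A merged vertex collects 2s >= 4 sums 20n + 1, so its colour exceeds both
    colours of the even vertices.\<close>
  have big: "30 * ?n + 2 < 2 * s * (20 * ?n + 1)"
  proof -
    have "30 * ?n + 2 < 4 * (20 * ?n + 1)" by simp
    also have "\<dots> \<le> 2 * s * (20 * ?n + 1)" using assms by (intro mult_le_mono1) simp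
    finally show ?thesis .
  qed
  have "induced_label ?G f ` verts ?G \<subseteq> {30 * ?n + 1, 30 * ?n + 2, 2 * s * (20 * ?n + 1)}"
    unfolding verts_H using odd_label even_label by (force split: if_splits)
  then have "card (induced_label ?G f ` verts ?G) \<le> card {30 * ?n + 1, 30 * ?n + 2, 2 * s * (20 * ?n + 1)}"
    by (intro card_mono) auto
  also have "\<dots> \<le> 3" by (simp add: card_insert_if)
  finally have card: "card (induced_label ?G f ` verts ?G) \<le> 3" .
  have proper: "induced_label ?G f (proj m r s v) \<noteq> induced_label ?G f (proj m r s w)"
    if e: "e \<in> edges (C482_copies ?n)" "e = {v, w}" "even (idx v)"
      "odd (idx w) \<or> (\<exists>i j. j \<in> {1..4} \<and> v = U i (2 * j) \<and> w = V i (2 * j))" for e v w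
  proof -
    obtain i k where ik: "e = edge i k" "k < 20" "i \<in> {1..?n}" using e(1) by (auto simp: edges_C482)
    have "v \<in> edge i k" "w \<in> edge i k" using e(2) ik(1) by auto
    then have cvw: "copy v = i" "copy w = i" using copy_edge by blast+
    have "idx u \<in> {1..8}" if "u \<in> edge i k" for u
      using that ik(2) by (auto simp: edge_def split: if_splits)
    then have vw: "v \<in> verts (C482_copies ?n)" "w \<in> verts (C482_copies ?n)"
      using e(2) ik cvw by (auto simp: verts_C482)
    show ?thesis
    proof (cases "even (idx w)")
      case True
      then obtain i j where j: "j \<in> {1..4}" "v = U i (2 * j)" "w = V i (2 * j)"
        using e(4) by blast
      then have "j = 1 \<or> j = 2 \<or> j = 3 \<or> j = 4" by auto
      then show ?thesis
        using even_label[OF vw(1) e(3)] even_label[OF vw(2) True] unfolding j(2,3)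
        by (elim disjE) simp_all
    next
      case False
      then show ?thesis using odd_label[OF vw(2)] even_label[OF vw(1)] e(3) big
        by (simp split: if_splits)
    qed
  qed
  have "induced_label ?G f u \<noteq> induced_label ?G f v"
    if "e \<in> edges ?G" "ends ?G e = {u, v}" for e u v
  proof -
    have e: "e \<in> edges (C482_copies ?n)" using that by (simp add: edges_H)
    then obtain a b where ab: "e = {a, b}" "even (idx a)"
      "odd (idx b) \<or> (\<exists>i j. j \<in> {1..4} \<and> a = U i (2 * j) \<and> b = V i (2 * j))" by (rule edge_cases)
    then have "{u, v} = {proj m r s a, proj m r s b}" using that by (simp add: ends_H)
    then show ?thesis using proper[OF e ab] by (auto simp: doubleton_eq_iff)
  qed
  then have "local_antimagic ?G f" using bij by (auto simp: local_antimagic_def edges_H)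
  then show ?thesis using card by blast
qed

subsection \<open>Two colours do not suffice\<close>

lemma local_antimagic_H_edge:
  assumes "local_antimagic (H m r s) f" "i \<in> {1..r * s}" "k < 20" "edge i k = {v, w}"
  shows "induced_label (H m r s) f (proj m r s v) \<noteq> induced_label (H m r s) f (proj m r s w)"
proof -
  have "{v, w} \<in> edges (H m r s)"
    using assms(2-4) by (force simp: edges_H edges_C482)
  moreover have "ends (H m r s) {v, w} = {proj m r s v, proj m r s w}" by (simp add: ends_H)
  ultimately show ?thesis using assms(1) unfolding local_antimagic_def by blast
qed

lemma chi_la_H_ge:
  assumes r: "1 \<le> r" and s: "2 \<le> s" and m: "m \<in> {1, 2, 3}" and f: "local_antimagic (H m r s) f"
  shows "3 \<le> card (induced_label (H m r s) f ` verts (H m r s))"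
proof -
  let ?G = "H m r s"
  define col where "col v = induced_label ?G f (proj m r s v)" for v
  \<comment> \<open>The whole argument stays in the first block, whose copies are numbered 1, ...,
    s.\<close>
  have i1: "i \<in> {1..r * s}" if "i \<in> {1..s}" for i
    using block_index_range[of 1 r i s] r that by simp
  have adj: "col v \<noteq> col w" if "i \<in> {1..s}" "k < 20" "edge i k = {v, w}" for i k v w
    unfolding col_def using local_antimagic_H_edge[OF f] i1 that by blast
  have one: "1 \<in> {1..s}" using s by simp
  have slot_col: "col v = induced_label ?G f (block m s 1 c)"
    if "i \<in> {1..s}" "c < 4" "v \<in> slot m i c" for v i c
    unfolding col_def using proj_slot[of 1 r i s c v m] r that by simp
  have col_in: "col v \<in> induced_label ?G f ` verts ?G" if "copy v \<in> {1..s}" "idx v \<in> {1..8}" for v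
    using that i1 by (auto simp: col_def verts_H verts_C482)
  have triangle: ?thesis if "col u \<noteq> col v" "col v \<noteq> col w" "col u \<noteq> col w"
    "copy u \<in> {1..s}" "copy v \<in> {1..s}" "copy w \<in> {1..s}" "idx u \<in> {1..8}" "idx v \<in> {1..8}" "idx w \<in> {1..8}"
    for u v w
  proof -
    have "card {col u, col v, col w} = 3" using that by simp
    moreover have "{col u, col v, col w} \<subseteq> induced_label ?G f ` verts ?G" using that col_in by simp
    ultimately show ?thesis using finite_verts_H by (metis card_mono finite_imageI)
  qed
  consider "m = 1" | "m = 2" | "m = 3" using m by blast
  then show ?thesis
  proof cases
    case 1
    show ?thesis
    proof (rule ccontr)
      assume neg: "\<not> ?thesis"
      \<comment> \<open>With fewer than three colours, two vertices that both differ in colour from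
        a third one agree.\<close>
      have two: "col u = col w" if "col u \<noteq> col v" "col v \<noteq> col w"
        "copy u \<in> {1..s}" "copy v \<in> {1..s}" "copy w \<in> {1..s}" "idx u \<in> {1..8}" "idx v \<in> {1..8}" "idx w \<in> {1..8}"
        for u v w
        using that neg triangle by blast
      let ?W = "induced_label (C482_copies (r * s)) f"
      define A B where "A = col (U 1 1)" and "B = col (U 1 2)"
      have AB: "A \<noteq> B" using adj[OF one _ edge_simps(1)] by (simp add: A_def B_def)
      have toB: "col v = B" if "col v \<noteq> A" "copy v \<in> {1..s}" "idx v \<in> {1..8}" for v
        using two[of v "U 1 1" "U 1 2"] that AB s by (simp add: A_def B_def)
      have toA: "col v = A" if "col v \<noteq> B" "copy v \<in> {1..s}" "idx v \<in> {1..8}" for v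
        using two[of v "U 1 2" "U 1 1"] that AB s by (simp add: A_def B_def)
      have blocks: "col v = (\<Sum>i\<in>{1..s}. \<Sum>w\<in>slot m i c. ?W w)"
        if "i \<in> {1..s}" "c < 4" "v \<in> slot m i c" for v i c
        using slot_col[OF that] induced_label_H_block[of 1 r c s m f] r s that by simp
      have even: "col v = ?W v" if "even (idx v)" for v
        unfolding col_def proj_even[OF that] induced_label_H_even[OF that] ..
      have cols: "col (U i 1) = A" "col (U i 5) = A" "col (U i 3) = A" "col (U i 7) = A"
        "col (V i 1) = B" "col (V i 5) = B" "col (V i 3) = B" "col (V i 7) = B"
        "col (U i 2) = B" "col (U i 4) = B" "col (U i 6) = B" "col (U i 8) = B"
        \<comment> \<open>The merged vertex containing \<open>U i 1\<close> and \<open>U i 5\<close>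
          is common to all copies of the block and fixes \<open>A\<close> for every
          \<open>i\<close>. From there the two colours alternate along the \<open>U\<close>-cycle,
          across the spokes and along the \<open>V\<close>-cycle.\<close>
        "col (V i 2) = A" "col (V i 4) = A" "col (V i 6) = A" "col (V i 8) = A" if i: "i \<in> {1..s}" for i
      proof -
        have i': "1 \<le> i" "i \<le> s" using i by simp_all
        show u1: "col (U i 1) = A" and u5: "col (U i 5) = A"
          using slot_col[OF i, of 0] slot_col[OF one, of 0] 1 by (simp_all add: slot_simps xv_def A_def)
        show u2: "col (U i 2) = B"
          using adj[OF i _ edge_simps(1)] u1 i' by (intro toB) auto
        show u8: "col (U i 8) = B"
          using adj[OF i _ edge_simps(8)] u1 i' by (intro toB) auto
        show u4: "col (U i 4) = B"
          using adj[OF i _ edge_simps(4)] u5 i' by (intro toB) auto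
        show u6: "col (U i 6) = B"
          using adj[OF i _ edge_simps(5)] u5 i' by (intro toB) auto
        show u3: "col (U i 3) = A"
          using adj[OF i _ edge_simps(2)] u2 i' by (intro toA) auto
        show u7: "col (U i 7) = A"
          using adj[OF i _ edge_simps(6)] u6 i' by (intro toA) auto
        show v2: "col (V i 2) = A"
          using adj[OF i _ edge_simps(17)] u2 i' by (intro toA) auto
        show v4: "col (V i 4) = A"
          using adj[OF i _ edge_simps(18)] u4 i' by (intro toA) auto
        show v6: "col (V i 6) = A"
          using adj[OF i _ edge_simps(19)] u6 i' by (intro toA) auto
        show v8: "col (V i 8) = A"
          using adj[OF i _ edge_simps(20)] u8 i' by (intro toA) auto
        show v1: "col (V i 1) = B"
          using adj[OF i _ edge_simps(9)] v2 i' by (intro toB) auto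
        show v3: "col (V i 3) = B"
          using adj[OF i _ edge_simps(10)] v2 i' by (intro toB) auto
        show v5: "col (V i 5) = B"
          using adj[OF i _ edge_simps(12)] v4 i' by (intro toB) auto
        show v7: "col (V i 7) = B"
          using adj[OF i _ edge_simps(14)] v6 i' by (intro toB) auto
      qed
      have slots: "slot m i 0 = {U i 1, U i 5}" "slot m i 1 = {U i 3, U i 7}"
        "slot m i 2 = {V i 1, V i 5}" "slot m i 3 = {V i 3, V i 7}" for i
        using 1 unfolding slot_simps by (simp_all add: xv_def yv_def)
      have A: "A = (\<Sum>i\<in>{1..s}. ?W (U i 1) + ?W (U i 5))" "A = (\<Sum>i\<in>{1..s}. ?W (U i 3) + ?W (U i 7))"
        using blocks[OF one, of 0 "U 1 1"] blocks[OF one, of 1 "U 1 3"] cols[OF one] unfolding slots by simp_all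
      have B: "B = (\<Sum>i\<in>{1..s}. ?W (V i 1) + ?W (V i 5))" "B = (\<Sum>i\<in>{1..s}. ?W (V i 3) + ?W (V i 7))"
        using blocks[OF one, of 2 "V 1 1"] blocks[OF one, of 3 "V 1 3"] cols[OF one] unfolding slots by simp_all
      have "s * (4 * B) = (\<Sum>i\<in>{1..s}. ?W (U i 2) + ?W (U i 4) + ?W (U i 6) + ?W (U i 8))"
        using cols by (simp add: even[symmetric])
      \<comment> \<open>The side coloured \<open>B\<close>: four even \<open>U\<close>-vertices per
        copy and the two merged y-vertices of the block.\<close>
      then have "s * (4 * B) + B + B = (\<Sum>i\<in>{1..s}. ?W (U i 2) + ?W (U i 4) + ?W (U i 6) + ?W (U i 8)
          + (?W (V i 1) + ?W (V i 5)) + (?W (V i 3) + ?W (V i 7)))"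
        unfolding sum.distrib[of _ _ "{1..s}"] using B by (simp add: sum.distrib)
      also have "\<dots> = (\<Sum>i\<in>{1..s}. ?W (V i 2) + ?W (V i 4) + ?W (V i 6) + ?W (V i 8)
          + (?W (U i 1) + ?W (U i 5)) + (?W (U i 3) + ?W (U i 7)))"
        \<comment> \<open>For each \<open>i\<close>, both summands are the total of the 20 edge
          labels of copy \<open>i\<close>, since every edge has exactly one end on each
          side.\<close>
        by (intro sum.cong refl) (simp only: induced_label_U[OF i1] induced_label_V[OF i1])
      also have "\<dots> = s * (4 * A) + A + A"
      proof -
        have "s * (4 * A) = (\<Sum>i\<in>{1..s}. ?W (V i 2) + ?W (V i 4) + ?W (V i 6) + ?W (V i 8))"
          using cols by (simp add: even[symmetric])
        then show ?thesis using A by (simp add: sum.distrib)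
      qed
      finally have "(4 * s + 2) * B = (4 * s + 2) * A" by (simp add: algebra_simps)
      then have "B = A \<or> 4 * s + 2 = 0" by (simp only: mult_cancel1)
      then show False using AB by simp
    qed
  next
    case 2
    \<comment> \<open>Merging \<open>U 1 3\<close> with \<open>V 1 5\<close> closes a triangle over
      the spoke from \<open>U 1 4\<close> to \<open>V 1 4\<close>.\<close>
    have "col (U 1 3) \<noteq> col (U 1 4)" using adj[OF one _ edge_simps(3)] by simp
    moreover have "col (U 1 4) \<noteq> col (V 1 4)" using adj[OF one _ edge_simps(18)] by simp
    moreover have "col (V 1 4) \<noteq> col (V 1 5)" using adj[OF one _ edge_simps(12)] by simp
    moreover have "col (U 1 3) = col (V 1 5)"
      using slot_col[OF one, of 2] 2 by (simp add: slot_simps yv_def)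
    ultimately show ?thesis using triangle[of "U 1 3" "U 1 4" "V 1 4"] s by simp
  next
    case 3
    \<comment> \<open>Here \<open>U 1 1\<close> and \<open>V 1 1\<close> are merged, giving a
      triangle over the spoke from \<open>U 1 2\<close> to \<open>V 1 2\<close>.\<close>
    have "col (U 1 1) \<noteq> col (U 1 2)" using adj[OF one _ edge_simps(1)] by simp
    moreover have "col (U 1 2) \<noteq> col (V 1 2)" using adj[OF one _ edge_simps(17)] by simp
    moreover have "col (V 1 1) \<noteq> col (V 1 2)" using adj[OF one _ edge_simps(9)] by simp
    moreover have "col (U 1 1) = col (V 1 1)"
      using slot_col[OF one, of 0] 3 by (simp add: slot_simps xv_def)
    ultimately show ?thesis using triangle[of "U 1 1" "U 1 2" "V 1 2"] s by simp
  qed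
qed

theorem theorem3p7:
  fixes r s m :: nat
  assumes "r \<ge> 1" and "s \<ge> 2" and "m \<in> {1, 2, 3}"
  shows "chi_la (H m r s) = 3"
proof -
  let ?S = "{card (induced_label (H m r s) f ` verts (H m r s)) | f. local_antimagic (H m r s) f}"
  obtain f where f: "local_antimagic (H m r s) f" "card (induced_label (H m r s) f ` verts (H m r s)) \<le> 3"
    using chi_la_H_le[OF assms(1,2)] by blast
  then have "card (induced_label (H m r s) f ` verts (H m r s)) = 3"
    using chi_la_H_ge[OF assms f(1)] by simp
  then have "3 \<in> ?S" using f(1) by (metis (mono_tags, lifting) mem_Collect_eq)
  moreover have "3 \<le> x" if "x \<in> ?S" for x
    using that chi_la_H_ge[OF assms] by blast
  ultimately show ?thesis unfolding chi_la_def by (rule cInf_eq_minimum)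
qed

end
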